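(* Let $G$ be a $d$-regular graph, $d\geq 7$, containing neither a cycle of length $4$ nor a cycle of length $6$. Then $b(G)=d+1$.
   Context: Graphs are finite and simple. Containing a cycle means containing it as a (not necessarily induced) subgraph. In a proper vertex coloring of a graph, a vertex of color $i$ is called dominant if it has a neighbor in each color class distinct from $i$. A $b$-coloring is a proper coloring in which each color class contains at least one dominant vertex. The $b$-chromatic number $b(G)$ is the largest positive integer $k$ such that $G$ has a $b$-coloring with $k$ colors. *)

theory Defs
  imports "Graph_Theory.Graph_Theory" "HOL-Library.FuncSet"
begin

text \<open>
  A finite simple graph is the library's locale \<^locale>\<open>graph\<close>: a finite symmetric digraph
  without loops and parallel arcs, where an edge is a pair of opposite arcs. Hence the degree
  of a vertex is its out-degree.
\<close>

definition regular :: "('a, 'b) pre_digraph \<Rightarrow> nat \<Rightarrow> bool" where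
  "regular G d \<longleftrightarrow> (\<forall>v \<in> verts G. out_degree G v = d)"

text \<open>
  The bound \<open>n \<ge> 3\<close> excludes a single edge traversed back and forth, which is a cycle of the
  underlying symmetric digraph but not of the undirected graph. Chords are allowed, i.e. the cycle
  is a not necessarily induced subgraph.
\<close>

definition contains_cycle :: "('a, 'b) pre_digraph \<Rightarrow> nat \<Rightarrow> bool" where
  "contains_cycle G n \<longleftrightarrow> n \<ge> 3 \<and> (\<exists>p. pre_digraph.cycle G p \<and> length p = n)"

definition proper_coloring :: "('a, 'b) pre_digraph \<Rightarrow> nat \<Rightarrow> ('a \<Rightarrow> nat) \<Rightarrow> bool" where
  "proper_coloring G k c \<longleftrightarrow>
     c \<in> verts G \<rightarrow> {..<k} \<and> (\<forall>u v. u \<rightarrow>\<^bsub>G\<^esub> v \<longrightarrow> c u \<noteq> c v)"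

definition dominant :: "('a, 'b) pre_digraph \<Rightarrow> nat \<Rightarrow> ('a \<Rightarrow> nat) \<Rightarrow> 'a \<Rightarrow> bool" where
  "dominant G k c v \<longleftrightarrow>
     v \<in> verts G \<and> (\<forall>i<k. i \<noteq> c v \<longrightarrow> (\<exists>w. v \<rightarrow>\<^bsub>G\<^esub> w \<and> c w = i))"

definition b_coloring :: "('a, 'b) pre_digraph \<Rightarrow> nat \<Rightarrow> ('a \<Rightarrow> nat) \<Rightarrow> bool" where
  "b_coloring G k c \<longleftrightarrow>
     proper_coloring G k c \<and> (\<forall>i<k. \<exists>v. c v = i \<and> dominant G k c v)"

definition b_chromatic_number :: "('a, 'b) pre_digraph \<Rightarrow> nat" where
  "b_chromatic_number G = (GREATEST k. k > 0 \<and> (\<exists>c. b_coloring G k c))"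

text \<open>The numbers over which the maximum is taken are bounded.\<close>

lemma b_coloring_le_card_verts:
  assumes "finite (verts G)" "b_coloring G k c"
  shows "k \<le> card (verts G)"
proof -
  have "{..<k} \<subseteq> c ` verts G"
    using assms(2) by (auto simp: b_coloring_def dominant_def)
  then have "card {..<k} \<le> card (verts G)"
    by (rule surj_card_le[OF assms(1)])
  then show ?thesis by simp
qed

end

theory Submission
  imports Defs
begin

text \<open>
  A dominant vertex sees every other color on its \<open>d\<close> neighbors, so a b-coloring has at most
  \<open>d + 1\<close> colors. A b-coloring with \<open>d + 1\<close> colors is built around an arbitrary vertex \<open>x\<close>, and
  the closed neighborhood \<open>N[x]\<close> itself serves as the set of colors: each vertex of \<open>N[x]\<close> is
  colored by itself and becomes the dominant vertex of its color.

  For \<open>x\<close> this is automatic. A neighbor \<open>u\<close> of \<open>x\<close> already sees \<open>x\<close> and the common neighbors of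
  \<open>u\<close> and \<open>x\<close>; the other colors, the set \<open>N(x) - N[u]\<close>, must appear on its block
  \<open>B\<^sub>u = N(u) - N[x]\<close>. As \<open>u\<close> and \<open>x\<close> have the same degree, the two sets have the same size, so
  \<open>B\<^sub>u\<close> has to be colored by a bijection onto \<open>N(x) - N[u]\<close>. Blocks are disjoint in the absence of
  4-cycles, so the bijections can be chosen separately, and the only danger comes from the edges
  between different blocks.

  These edges are scarce. Without cycles of length 4 or 6, there is at most one edge between
  two given blocks (\<open>cross_injective\<close>), a vertex of a block sends edges into at most one other
  block (\<open>cross_functional\<close>), and there is no edge between the blocks of adjacent \<open>u\<close> and \<open>w\<close>
  (\<open>cross_in_missing_labels\<close>). Hence it is possible to prescribe that a vertex of \<open>B\<^sub>u\<close> with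
  a neighbor in \<open>B\<^sub>w\<close> gets the color \<open>w\<close>: this is an injective partial map into \<open>N(x) - N[u]\<close>,
  which extends to a bijection. The two ends of an edge between \<open>B\<^sub>u\<close> and \<open>B\<^sub>w\<close> then have the
  distinct colors \<open>w\<close> and \<open>u\<close>.

  So the vertices at distance at most two from \<open>x\<close> are properly colored with every vertex
  of \<open>N[x]\<close> dominant, and the greedy algorithm extends the coloring to the rest of the graph.
\<close>

section \<open>Cycles as lists of vertices\<close>

lemma (in wf_digraph) awalk_of_vwalk:
  assumes "vwalk p G"
  shows "\<exists>as. awalk (hd p) as (last p) \<and> awalk_verts (hd p) as = p"
  using assms
proof (induction rule: vwalk_induct)
  case (Base u)
  then show ?case by (auto intro!: exI[of _ "[]"] simp: awalk_Nil_iff)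
next
  case (Cons u v es)
  then obtain as where as: "awalk v as (last (v # es))" "awalk_verts v as = v # es"
    by auto
  from Cons.hyps obtain e where "e \<in> arcs G" "tail G e = u" "head G e = v"
    by (auto simp: arcs_ends_conv)
  then show ?case
    using as by (intro exI[of _ "e # as"]) (auto simp: awalk_Cons_iff)
qed

lemma (in wf_digraph) contains_cycle_of_closed_vwalk:
  assumes "vwalk (last vs # vs) G" "distinct vs" "length vs \<ge> 3"
  shows "contains_cycle G (length vs)"
proof -
  obtain as where as: "awalk (last vs) as (last vs)" "awalk_verts (last vs) as = last vs # vs"
    using awalk_of_vwalk[OF assms(1)] assms(3) by (auto split: if_splits)
  have "length as = length vs"
    using length_awalk_verts[of "last vs" as] as(2) by simp
  moreover have "cycle as"
    unfolding cycle_def using as assms(2,3) \<open>length as = length vs\<close>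
    by (intro exI[of _ "last vs"]) auto
  ultimately show ?thesis
    unfolding contains_cycle_def using assms(3) by blast
qed

section \<open>Neighborhoods, and greedy extension of a coloring\<close>

definition neighborhood :: "('a, 'b) pre_digraph \<Rightarrow> 'a \<Rightarrow> 'a set" where
  "neighborhood G v = {w. v \<rightarrow>\<^bsub>G\<^esub> w}"

definition closed_neighborhood :: "('a, 'b) pre_digraph \<Rightarrow> 'a \<Rightarrow> 'a set" where
  "closed_neighborhood G v = insert v (neighborhood G v)"

lemma (in nomulti_digraph) card_neighborhood:
  "card (neighborhood G v) = out_degree G v"
proof -
  have "neighborhood G v = head G ` out_arcs G v"
    by (auto simp: neighborhood_def arcs_ends_conv)
  moreover have "inj_on (head G) (out_arcs G v)"
    by (auto simp: inj_on_def arc_to_ends_def intro!: no_multi_arcs)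
  ultimately show ?thesis
    by (simp add: out_degree_def card_image)
qed

context graph
begin

lemma neighborhood_subset_verts: "neighborhood G v \<subseteq> verts G"
  by (auto simp: neighborhood_def dest: adj_in_verts)

lemma finite_neighborhood: "finite (neighborhood G v)"
  using finite_subset[OF neighborhood_subset_verts] by simp

lemma neighborhood_sym: "w \<in> neighborhood G v \<longleftrightarrow> v \<in> neighborhood G w"
  unfolding neighborhood_def using arcs_ends_symmetric[OF sym_arcs] by blast

lemma not_in_neighborhood_self: "v \<notin> neighborhood G v"
  by (auto simp: neighborhood_def dest: adj_not_same)

text \<open>
  An uncolored vertex can always be colored next, since its neighbors are too few to occupy all
  the colors in \<open>C\<close>.
\<close>

lemma greedy_extension:
  assumes deg: "\<And>v. v \<in> verts G \<Longrightarrow> card (neighborhood G v) < card C"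
    and S: "S \<subseteq> verts G" "\<phi> ` S \<subseteq> C"
    and proper: "\<And>u v. u \<in> S \<Longrightarrow> v \<in> S \<Longrightarrow> v \<in> neighborhood G u \<Longrightarrow> \<phi> u \<noteq> \<phi> v"
  shows "\<exists>\<psi>. (\<forall>v\<in>S. \<psi> v = \<phi> v) \<and> \<psi> ` verts G \<subseteq> C \<and>
    (\<forall>u v. v \<in> neighborhood G u \<longrightarrow> \<psi> u \<noteq> \<psi> v)"
proof -
  have fin: "finite (verts G - S)" by simp
  from fin S proper show ?thesis
  proof (induction "verts G - S" arbitrary: S \<phi> rule: finite_psubset_induct)
    case psubset
    show ?case
    proof (cases "S = verts G")
      case True
      have "u \<in> S" "v \<in> S" if "v \<in> neighborhood G u" for u v
        using neighborhood_subset_verts that neighborhood_sym[of v u] unfolding True by blast+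
      then show ?thesis using psubset.prems True by blast
    next
      case False
      then obtain z where z: "z \<in> verts G" "z \<notin> S" using psubset.prems(1) by blast
      have "card (\<phi> ` neighborhood G z) < card C"
        using deg[OF z(1)] card_image_le[OF finite_neighborhood, of \<phi> z] by linarith
      then have "\<not> C \<subseteq> \<phi> ` neighborhood G z"
        using card_mono[OF finite_imageI[OF finite_neighborhood], of C \<phi> z] by linarith
      then obtain k where k: "k \<in> C" "k \<notin> \<phi> ` neighborhood G z"
        by blast
      have "\<exists>\<psi>. (\<forall>v\<in>insert z S. \<psi> v = (\<phi>(z := k)) v) \<and> \<psi> ` verts G \<subseteq> C \<and>
          (\<forall>u v. v \<in> neighborhood G u \<longrightarrow> \<psi> u \<noteq> \<psi> v)"
      proof (rule psubset.hyps(2))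
        show "verts G - insert z S \<subset> verts G - S" using z by blast
        show "insert z S \<subseteq> verts G" using z psubset.prems(1) by blast
        show "(\<phi>(z := k)) ` insert z S \<subseteq> C" using k psubset.prems(2) by auto
        show "(\<phi>(z := k)) u \<noteq> (\<phi>(z := k)) v"
          if "u \<in> insert z S" "v \<in> insert z S" "v \<in> neighborhood G u" for u v
        proof -
          have "v \<noteq> u" using that(3) not_in_neighborhood_self by blast
          with that(1,2) z(2) consider "u = z" "v \<in> S" "v \<noteq> z" | "v = z" "u \<in> S" "u \<noteq> z"
            | "u \<in> S" "v \<in> S" "u \<noteq> z" "v \<noteq> z"
            by blast
          then show ?thesis
          proof cases
            case 1
            then show ?thesis using k(2) that(3) by auto
          next
            case 2
            then have "u \<in> neighborhood G z" using that(3) by (metis neighborhood_sym)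
            then show ?thesis using k(2) 2 by auto
          next
            case 3
            then show ?thesis using psubset.prems(3) that(3) by simp
          qed
        qed
      qed
      then show ?thesis using z(2) by (metis fun_upd_other insertI2)
    qed
  qed
qed

end

section \<open>The blocks of the second neighborhood\<close>

text \<open>
  For the neighbors \<open>u\<close> of \<open>x\<close>, the blocks partition the vertices at distance two from \<open>x\<close> if
  there is no cycle of length 4.
\<close>

definition block :: "('a, 'b) pre_digraph \<Rightarrow> 'a \<Rightarrow> 'a \<Rightarrow> 'a set" where
  "block G x u = neighborhood G u - closed_neighborhood G x"

text \<open>
  With every vertex of \<open>N[x]\<close> labelled by itself, these are the labels that \<open>u\<close> does not yet
  see on its closed neighborhood, so that its block has to supply them.
\<close>

definition missing_labels :: "('a, 'b) pre_digraph \<Rightarrow> 'a \<Rightarrow> 'a \<Rightarrow> 'a set" where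
  "missing_labels G x u = neighborhood G x - closed_neighborhood G u"

text \<open>
  This is a relation between the vertices \<open>y\<close> of the block of \<open>u\<close> and the owners \<open>w\<close> of the
  other blocks into which they send edges, because the owner is to be the label of \<open>y\<close>.
\<close>

definition cross :: "('a, 'b) pre_digraph \<Rightarrow> 'a \<Rightarrow> 'a \<Rightarrow> 'a \<Rightarrow> 'a \<Rightarrow> bool" where
  "cross G x u y w \<longleftrightarrow> y \<in> block G x u \<and> w \<in> neighborhood G x \<and> w \<noteq> u \<and>
     (\<exists>z \<in> block G x w. z \<in> neighborhood G y)"

text \<open>
  Both sets arise from a neighborhood by removing the common neighbors of \<open>u\<close> and \<open>x\<close> and one
  further vertex, which is \<open>x\<close> in the first case and \<open>u\<close> in the second.
\<close>

lemma (in graph) card_missing_labels: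
  assumes "u \<in> neighborhood G x" "card (neighborhood G u) = card (neighborhood G x)"
  shows "card (missing_labels G x u) = card (block G x u)"
proof -
  let ?I = "neighborhood G u \<inter> neighborhood G x"
  have "block G x u = neighborhood G u - insert x ?I"
    "missing_labels G x u = neighborhood G x - insert u ?I"
    by (auto simp: block_def missing_labels_def closed_neighborhood_def)
  moreover have "x \<in> neighborhood G u" "x \<notin> ?I" "u \<notin> ?I"
    using assms(1) neighborhood_sym not_in_neighborhood_self by blast+
  ultimately show ?thesis
    using assms by (simp add: card_Diff_subset finite_neighborhood)
qed

locale C4_C6_free_graph = graph +
  assumes no_C4: "\<not> contains_cycle G 4"
    and no_C6: "\<not> contains_cycle G 6"
begin

lemma common_neighbor_unique:
  assumes "c \<in> neighborhood G a" "c \<in> neighborhood G b"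
    "e \<in> neighborhood G a" "e \<in> neighborhood G b" "a \<noteq> b"
  shows "c = e"
proof (rule ccontr)
  assume "c \<noteq> e"
  have "distinct [a, c, b, e]"
    using assms \<open>c \<noteq> e\<close> not_in_neighborhood_self by auto
  moreover have "vwalk [e, a, c, b, e] G"
  proof -
    have "a \<in> neighborhood G e" "b \<in> neighborhood G c"
      using assms neighborhood_sym by blast+
    then show ?thesis
      using assms by (auto simp: vwalk_def neighborhood_def dest: adj_in_verts)
  qed
  ultimately have "contains_cycle G 4"
    using contains_cycle_of_closed_vwalk[of "[a, c, b, e]"] by (simp add: eval_nat_numeral)
  then show False using no_C4 by blast
qed

lemma no_hexagon:
  assumes "b \<in> neighborhood G a" "c \<in> neighborhood G b" "e \<in> neighborhood G c"
    "f \<in> neighborhood G e" "g \<in> neighborhood G f" "a \<in> neighborhood G g"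
    "distinct [a, b, c, e, f, g]"
  shows False
proof -
  have "vwalk [g, a, b, c, e, f, g] G"
    using assms by (auto simp: vwalk_def neighborhood_def dest: adj_in_verts)
  then have "contains_cycle G 6"
    using contains_cycle_of_closed_vwalk[of "[a, b, c, e, f, g]"] assms(7) by (simp add: eval_nat_numeral)
  then show False using no_C6 by blast
qed

lemma blocks_disjoint:
  assumes "u \<in> neighborhood G x" "w \<in> neighborhood G x" "y \<in> block G x u" "y \<in> block G x w"
  shows "u = w"
proof (rule ccontr)
  assume "u \<noteq> w"
  moreover have "x \<in> neighborhood G u" "x \<in> neighborhood G w"
      "y \<in> neighborhood G u" "y \<in> neighborhood G w"
    using assms neighborhood_sym unfolding block_def by blast+
  ultimately have "x = y" using common_neighbor_unique by blast
  then show False using assms(3) by (simp add: block_def closed_neighborhood_def)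
qed

text \<open>
  The owner \<open>w\<close> is an admissible label for \<open>y\<close>: an edge between the blocks of adjacent \<open>u\<close> and
  \<open>w\<close> would close up with the edge from \<open>u\<close> to \<open>w\<close>.
\<close>

lemma cross_in_missing_labels:
  assumes "u \<in> neighborhood G x" "cross G x u y w"
  shows "w \<in> missing_labels G x u"
proof -
  have False if "w \<in> neighborhood G u"
  proof -
    obtain z where z: "z \<in> block G x w" "z \<in> neighborhood G y"
      using assms(2) by (auto simp: cross_def)
    \<comment> \<open>Then \<open>u\<close>, \<open>y\<close>, \<open>z\<close>, \<open>w\<close> would be a cycle of length 4.\<close>
    have "y \<in> neighborhood G u" "y \<in> neighborhood G z" "w \<in> neighborhood G z"
      using assms(2) z neighborhood_sym unfolding block_def cross_def by blast+
    moreover have "u \<noteq> z" using assms(1) z(1) by (auto simp: block_def closed_neighborhood_def)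
    ultimately have "y = w" using that common_neighbor_unique by blast
    then show False using assms(2) by (auto simp: cross_def block_def closed_neighborhood_def)
  qed
  then show ?thesis
    using assms by (auto simp: missing_labels_def cross_def closed_neighborhood_def)
qed

text \<open>
  If \<open>y\<close> sent edges to the blocks of \<open>w\<close> and \<open>w'\<close>, the path through \<open>y\<close> that joins the two
  blocks would close through \<open>w\<close>, \<open>x\<close>, \<open>w'\<close> to a cycle of length 6.
\<close>

lemma cross_functional:
  assumes "u \<in> neighborhood G x" "cross G x u y w" "cross G x u y w'"
  shows "w = w'"
proof (rule ccontr)
  assume ne: "w \<noteq> w'"
  obtain z z' where z: "z \<in> block G x w" "z \<in> neighborhood G y"
      "z' \<in> block G x w'" "z' \<in> neighborhood G y"
    using assms(2,3) by (auto simp: cross_def)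
  have w: "w \<in> neighborhood G x" "w' \<in> neighborhood G x" "y \<in> block G x u" "w \<noteq> u" "w' \<noteq> u"
    using assms by (auto simp: cross_def)
  have "z \<noteq> z'" using blocks_disjoint z w ne by blast
  moreover have "y \<noteq> z" "y \<noteq> z'" using z not_in_neighborhood_self by blast+
  moreover have "x \<noteq> w" "x \<noteq> w'" using w not_in_neighborhood_self by blast+
  moreover have "v \<noteq> x" "v \<noteq> w" "v \<noteq> w'" if "v \<in> {y, z, z'}" for v
    using that z w by (auto simp: block_def closed_neighborhood_def)
  ultimately have "distinct [w, z, y, z', w', x]" using ne by auto
  moreover have "z \<in> neighborhood G w" "y \<in> neighborhood G z" "w' \<in> neighborhood G z'"
      "x \<in> neighborhood G w'"
    using z w neighborhood_sym unfolding block_def by blast+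
  ultimately show False using no_hexagon z(4) w(1) by blast
qed

text \<open>
  Two edges between the blocks of \<open>u\<close> and \<open>w\<close> would lie on a cycle of length 4 if they had a
  common endpoint, and on a cycle of length 6 through \<open>u\<close> and \<open>w\<close> if they were disjoint.
\<close>

lemma cross_injective:
  assumes "u \<in> neighborhood G x" "cross G x u y w" "cross G x u y' w"
  shows "y = y'"
proof (rule ccontr)
  assume ne: "y \<noteq> y'"
  obtain z z' where z: "z \<in> block G x w" "z \<in> neighborhood G y"
      "z' \<in> block G x w" "z' \<in> neighborhood G y'"
    using assms(2,3) by (auto simp: cross_def)
  have w: "w \<in> neighborhood G x" "y \<in> block G x u" "y' \<in> block G x u" "w \<noteq> u"
    using assms by (auto simp: cross_def)
  have "z \<noteq> u" "z' \<noteq> u" "y \<noteq> w" "y' \<noteq> w"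
    using z w assms(1) by (auto simp: block_def closed_neighborhood_def)
  show False
  proof (cases "z = z'")
    case True
    have "y \<in> neighborhood G u" "y \<in> neighborhood G z"
        "y' \<in> neighborhood G u" "y' \<in> neighborhood G z"
      using z w True neighborhood_sym unfolding block_def by blast+
    then have "y = y'" using \<open>z \<noteq> u\<close> common_neighbor_unique by blast
    then show False using ne by blast
  next
    case False
    have "y \<noteq> z" "y \<noteq> z'" "y' \<noteq> z" "y' \<noteq> z'"
      using blocks_disjoint[OF assms(1) w(1)] w z by blast+
    moreover have "u \<noteq> y" "u \<noteq> y'" "w \<noteq> z" "w \<noteq> z'"
      using w z not_in_neighborhood_self by (auto simp: block_def)
    ultimately have "distinct [y, u, y', z', w, z]"
      using w ne False \<open>z \<noteq> u\<close> \<open>z' \<noteq> u\<close> \<open>y \<noteq> w\<close> \<open>y' \<noteq> w\<close> by auto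
    moreover have "u \<in> neighborhood G y" "y' \<in> neighborhood G u" "w \<in> neighborhood G z'"
        "z \<in> neighborhood G w" "y \<in> neighborhood G z"
      using z w neighborhood_sym unfolding block_def by blast+
    ultimately show False using no_hexagon z(4) by blast
  qed
qed

end

section \<open>Labelling the blocks\<close>

text \<open>
  The domain and the range of a partial injection have the same size, hence so have their
  complements.
\<close>

lemma extend_partial_injection:
  assumes fin: "finite A" "finite B" and card: "card A = card B"
    and R: "\<And>a b. R a b \<Longrightarrow> a \<in> A \<and> b \<in> B"
    and functional: "\<And>a b b'. R a b \<Longrightarrow> R a b' \<Longrightarrow> b = b'"
    and injective: "\<And>a a' b. R a b \<Longrightarrow> R a' b \<Longrightarrow> a = a'"
  shows "\<exists>g. bij_betw g A B \<and> (\<forall>a b. R a b \<longrightarrow> g a = b)"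
proof -
  define f where "f a = (THE b. R a b)" for a
  have f: "f a = b" if "R a b" for a b
    unfolding f_def using that functional by blast
  let ?A = "{a. \<exists>b. R a b}" and ?B = "{b. \<exists>a. R a b}"
  have sub: "?A \<subseteq> A" "?B \<subseteq> B" using R by blast+
  have bf: "bij_betw f ?A ?B"
    unfolding bij_betw_def inj_on_def image_def using f injective by (auto; metis)
  have "card (A - ?A) = card (B - ?B)"
    using card bij_betw_same_card[OF bf] fin sub
    by (simp add: card_Diff_subset finite_subset)
  then obtain h where h: "bij_betw h (A - ?A) (B - ?B)"
    using fin finite_same_card_bij[of "A - ?A" "B - ?B"] by blast
  define g where "g a = (if a \<in> ?A then f a else h a)" for a
  have g1: "bij_betw g ?A ?B"
    using bf by (rule bij_betw_cong[THEN iffD1, rotated]) (simp add: g_def)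
  have g2: "bij_betw g (A - ?A) (B - ?B)"
    using h by (rule bij_betw_cong[THEN iffD1, rotated]) (auto simp add: g_def)
  have "bij_betw g (?A \<union> (A - ?A)) (?B \<union> (B - ?B))"
    by (rule bij_betw_combine[OF g1 g2]) blast
  moreover have "?A \<union> (A - ?A) = A" "?B \<union> (B - ?B) = B" using sub by blast+
  ultimately have "bij_betw g A B" by simp
  moreover have "g a = b" if "R a b" for a b using f that by (auto simp: g_def)
  ultimately show ?thesis by blast
qed

context C4_C6_free_graph
begin

lemma block_labelling:
  assumes "u \<in> neighborhood G x" "card (neighborhood G u) = card (neighborhood G x)"
  shows "\<exists>g. bij_betw g (block G x u) (missing_labels G x u) \<and>
    (\<forall>y w. cross G x u y w \<longrightarrow> g y = w)"
proof (rule extend_partial_injection)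
  show "finite (block G x u)" "finite (missing_labels G x u)"
    by (simp_all add: block_def missing_labels_def finite_neighborhood)
  show "card (block G x u) = card (missing_labels G x u)"
    using card_missing_labels[OF assms] by simp
  show "y \<in> block G x u \<and> w \<in> missing_labels G x u" if "cross G x u y w" for y w
    using cross_in_missing_labels[OF assms(1) that] that by (simp add: cross_def)
qed (use cross_functional[OF assms(1)] cross_injective[OF assms(1)] in blast)+

text \<open>
  The labels are the vertices of the closed neighborhood of \<open>x\<close>, each of which carries itself as
  a label. An edge between the blocks of \<open>u\<close> and \<open>w\<close> gets the label \<open>w\<close> at its end in the block
  of \<open>u\<close> and the label \<open>u\<close> at its other end, so the choices made independently in the blocks are
  compatible.
\<close>

lemma dominating_labelling:
  assumes reg: "\<And>u. u \<in> neighborhood G x \<Longrightarrow> card (neighborhood G u) = card (neighborhood G x)"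
  defines "C \<equiv> closed_neighborhood G x"
  defines "S \<equiv> (\<Union>u\<in>C. closed_neighborhood G u)"
  obtains \<phi> where "\<And>u. u \<in> C \<Longrightarrow> \<phi> u = u"
    and "\<And>u. u \<in> C \<Longrightarrow> \<phi> ` closed_neighborhood G u = C"
    and "\<And>u v. u \<in> S \<Longrightarrow> v \<in> S \<Longrightarrow> v \<in> neighborhood G u \<Longrightarrow> \<phi> u \<noteq> \<phi> v"
proof -
  obtain g where g: "\<And>u. u \<in> neighborhood G x \<Longrightarrow>
      bij_betw (g u) (block G x u) (missing_labels G x u)"
    and gc: "\<And>u y w. u \<in> neighborhood G x \<Longrightarrow> cross G x u y w \<Longrightarrow> g u y = w"
    using block_labelling[OF _ reg] by metis
  define owner where "owner y = (THE u. u \<in> neighborhood G x \<and> y \<in> block G x u)" for y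
  define \<phi> where "\<phi> y = (if y \<in> C then y else g (owner y) y)" for y
  have \<phi>_C: "\<phi> y = y" if "y \<in> C" for y using that by (simp add: \<phi>_def)
  have \<phi>_block: "\<phi> y = g u y" if "u \<in> neighborhood G x" "y \<in> block G x u" for u y
  proof -
    have "owner y = u"
      unfolding owner_def using that blocks_disjoint by blast
    then show ?thesis using that by (simp add: \<phi>_def block_def C_def)
  qed
  have image_block: "\<phi> ` block G x u = missing_labels G x u" if "u \<in> neighborhood G x" for u
    using g[OF that] \<phi>_block[OF that] by (simp add: bij_betw_def)
  have image: "\<phi> ` closed_neighborhood G u = C" if "u \<in> C" for u
  proof (cases "u = x")
    case True
    then show ?thesis using \<phi>_C by (simp add: C_def)
  next
    case False
    then have u: "u \<in> neighborhood G x" using that by (simp add: C_def closed_neighborhood_def)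
    have "closed_neighborhood G u = (closed_neighborhood G u \<inter> C) \<union> block G x u"
      using that by (auto simp: closed_neighborhood_def block_def C_def)
    moreover have "\<phi> ` (closed_neighborhood G u \<inter> C) = closed_neighborhood G u \<inter> C"
      using \<phi>_C by (auto simp: image_def)
    moreover have "(closed_neighborhood G u \<inter> C) \<union> missing_labels G x u = C"
      using u neighborhood_sym[of x u]
      by (auto simp: closed_neighborhood_def missing_labels_def C_def)
    ultimately show ?thesis using image_block[OF u] by (metis image_Un)
  qed
  have S_cases: "v \<in> C \<or> (\<exists>u \<in> neighborhood G x. v \<in> block G x u)" if "v \<in> S" for v
    using that by (auto simp: S_def C_def closed_neighborhood_def block_def)
  \<comment> \<open>A vertex of \<open>C\<close> adjacent to a block vertex \<open>b\<close> owns the block of \<open>b\<close>, on which its label is not used.\<close>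
  have mixed: "\<phi> a \<noteq> \<phi> b"
    if a: "a \<in> C" and u: "u \<in> neighborhood G x" "b \<in> block G x u" and ab: "b \<in> neighborhood G a"
    for a b u
  proof -
    have "a \<noteq> x" "b \<notin> C" using u ab by (auto simp: block_def closed_neighborhood_def C_def)
    then have "a \<in> neighborhood G x" "b \<in> block G x a"
      using a ab by (auto simp: block_def closed_neighborhood_def C_def)
    then have "a = u" using blocks_disjoint u by blast
    then have "\<phi> b \<in> missing_labels G x a" using image_block u by blast
    then show ?thesis using \<phi>_C[OF a] by (auto simp: missing_labels_def closed_neighborhood_def)
  qed
  have "\<phi> a \<noteq> \<phi> b" if S: "a \<in> S" "b \<in> S" and ab: "b \<in> neighborhood G a" for a b
  proof -
    have ba: "a \<in> neighborhood G b" using ab neighborhood_sym by blast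
    have "a \<noteq> b" using ab not_in_neighborhood_self by blast
    consider "a \<in> C" "b \<in> C" | u where "a \<in> C" "u \<in> neighborhood G x" "b \<in> block G x u"
      | u where "b \<in> C" "u \<in> neighborhood G x" "a \<in> block G x u"
      | u w where "u \<in> neighborhood G x" "a \<in> block G x u" "w \<in> neighborhood G x" "b \<in> block G x w"
      using S_cases[OF S(1)] S_cases[OF S(2)] by blast
    then show ?thesis
    proof cases
      case 1
      then show ?thesis using \<phi>_C \<open>a \<noteq> b\<close> by simp
    next
      case 2
      then show ?thesis using mixed ab by blast
    next
      case 3
      then show ?thesis using mixed ba by metis
    next
      case 4
      show ?thesis
      proof (cases "u = w")
        case True
        then show ?thesis
          using 4 g[OF 4(1)] \<open>a \<noteq> b\<close> \<phi>_block by (metis bij_betw_def inj_on_def)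
      next
        case False
        then have "cross G x u a w" "cross G x w b u" using 4 ab ba by (auto simp: cross_def)
        then show ?thesis using gc \<phi>_block 4 False by metis
      qed
    qed
  qed
  then show thesis using that \<phi>_C image by blast
qed

end

section \<open>The b-chromatic number\<close>

lemma (in graph) b_coloring_le_degree:
  assumes "regular G d" "b_coloring G k c"
  shows "k \<le> d + 1"
proof (cases "k = 0")
  case False
  then obtain v where v: "c v = 0" "dominant G k c v"
    using assms(2) by (auto simp: b_coloring_def)
  have "{..<k} - {0} \<subseteq> c ` neighborhood G v"
    using v by (fastforce simp: dominant_def neighborhood_def)
  then have "card ({..<k} - {0}) \<le> card (neighborhood G v)"
    by (rule surj_card_le[OF finite_neighborhood])
  moreover have "card (neighborhood G v) = d"
    using assms(1) v(2) card_neighborhood by (simp add: regular_def dominant_def)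
  ultimately show ?thesis using False by simp
qed simp

text \<open>
  The vertices of the closed neighborhood of \<open>x\<close> are the colors until the end, where a bijection
  \<open>h\<close> turns them into numbers.
\<close>

lemma (in C4_C6_free_graph) ex_b_coloring:
  assumes reg: "regular G d" and x: "x \<in> verts G"
  shows "\<exists>c. b_coloring G (d + 1) c"
proof -
  have deg: "card (neighborhood G v) = d" if "v \<in> verts G" for v
    using reg that card_neighborhood by (simp add: regular_def)
  have same_degree: "card (neighborhood G u) = card (neighborhood G x)"
    if "u \<in> neighborhood G x" for u
    using that deg x neighborhood_subset_verts by (metis subsetD)
  define C where "C = closed_neighborhood G x"
  define S where "S = (\<Union>u\<in>C. closed_neighborhood G u)"
  have C: "finite C" "card C = d + 1" "C \<subseteq> verts G"
    using x deg[OF x] finite_neighborhood not_in_neighborhood_self neighborhood_subset_verts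
    by (auto simp: C_def closed_neighborhood_def)
  have S: "S \<subseteq> verts G" "C \<subseteq> S"
    using C(3) neighborhood_subset_verts by (fastforce simp: S_def closed_neighborhood_def)+
  obtain \<phi> where id: "\<And>u. u \<in> C \<Longrightarrow> \<phi> u = u"
    and image: "\<And>u. u \<in> C \<Longrightarrow> \<phi> ` closed_neighborhood G u = C"
    and proper: "\<And>u v. u \<in> S \<Longrightarrow> v \<in> S \<Longrightarrow> v \<in> neighborhood G u \<Longrightarrow> \<phi> u \<noteq> \<phi> v"
    using dominating_labelling[OF same_degree, folded C_def, folded S_def] by blast
  have "\<phi> ` S \<subseteq> C" using image by (auto simp: S_def)
  then obtain \<psi> where \<psi>: "\<forall>v\<in>S. \<psi> v = \<phi> v" "\<psi> ` verts G \<subseteq> C"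
      "\<forall>u v. v \<in> neighborhood G u \<longrightarrow> \<psi> u \<noteq> \<psi> v"
    using greedy_extension[of C S \<phi>] deg C(2) S(1) proper by auto
  obtain h where h: "bij_betw h C {..<d + 1}"
    using finite_same_card_bij[OF C(1), of "{..<d + 1}"] C(2) by auto
  have inj: "h a = h b \<longleftrightarrow> a = b" if "a \<in> C" "b \<in> C" for a b
    using h that by (auto simp: bij_betw_def inj_on_def)
  have "proper_coloring G (d + 1) (h \<circ> \<psi>)"
    unfolding proper_coloring_def
  proof (intro conjI allI impI)
    show "h \<circ> \<psi> \<in> verts G \<rightarrow> {..<d + 1}"
    proof
      fix v assume "v \<in> verts G"
      then have "\<psi> v \<in> C" using \<psi>(2) by blast
      then show "(h \<circ> \<psi>) v \<in> {..<d + 1}" using bij_betwE[OF h] by simp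
    qed
    show "(h \<circ> \<psi>) u \<noteq> (h \<circ> \<psi>) v" if "u \<rightarrow>\<^bsub>G\<^esub> v" for u v
    proof -
      have "\<psi> u \<in> C" "\<psi> v \<in> C" using \<psi>(2) adj_in_verts[OF that] by auto
      then show ?thesis using that \<psi>(3) inj by (simp add: neighborhood_def)
    qed
  qed
  moreover have "\<exists>u. (h \<circ> \<psi>) u = i \<and> dominant G (d + 1) (h \<circ> \<psi>) u" if "i < d + 1" for i
  proof -
    obtain u where u: "u \<in> C" "h u = i" using bij_betw_imp_surj_on[OF h] \<open>i < d + 1\<close>
      by (metis imageE lessThan_iff)
    have \<psi>u: "\<psi> u = u" using \<psi>(1) id u(1) S(2) by auto
    have "\<exists>w. u \<rightarrow>\<^bsub>G\<^esub> w \<and> (h \<circ> \<psi>) w = j" if "j < d + 1" "j \<noteq> i" for j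
    proof -
      obtain v where v: "v \<in> C" "h v = j" using bij_betw_imp_surj_on[OF h] \<open>j < d + 1\<close>
        by (metis imageE lessThan_iff)
      then obtain w where w: "w \<in> closed_neighborhood G u" "\<phi> w = v"
        using image[OF u(1)] by (metis imageE)
      then have "\<psi> w = v" using \<psi>(1) u(1) by (auto simp: S_def)
      moreover have "w \<noteq> u" using \<psi>u \<open>\<psi> w = v\<close> u v that by auto
      ultimately show ?thesis
        using w(1) v(2) by (auto simp: closed_neighborhood_def neighborhood_def)
    qed
    then have "dominant G (d + 1) (h \<circ> \<psi>) u"
      using u C(3) \<psi>u by (auto simp: dominant_def)
    then show ?thesis using u(2) \<psi>u by (intro exI[of _ u]) simp
  qed
  ultimately show ?thesis unfolding b_coloring_def by blast
qed

theorem theorem2p1: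
  fixes G :: "('a, 'b) pre_digraph" and d :: nat
  assumes "graph G"
    and "verts G \<noteq> {}"
    and "regular G d"
    and "d \<ge> 7"
    and "\<not> contains_cycle G 4"
    and "\<not> contains_cycle G 6"
  shows "b_chromatic_number G = d + 1"
proof -
  interpret C4_C6_free_graph G
    using assms(1,5,6) by (simp add: C4_C6_free_graph_def C4_C6_free_graph_axioms_def)
  show ?thesis
    unfolding b_chromatic_number_def
    using assms(2,3) ex_b_coloring b_coloring_le_degree
    by (intro Greatest_equality) auto
qed

end
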